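(* For every fixed integer $d\ge 1$, the number of $d$-dimensional permutations of order $n$ satisfies $|S_{d,n}|\ge \exp(\Omega(n^d))$ for even $n$; that is, there is a constant $c>0$ depending only on $d$ such that $|S_{d,n}|\ge \exp(c\,n^d)$ for every even integer $n\ge 2$.
   Context: Write $[n]=\{1,\dots,n\}$. A line of an $[n]^{m}$ array $P$ is a vector of the form $\big(P(i_1,\dots,i_{j-1},t,i_{j+1},\dots,i_m)\big)_{t=1}^n$, where $1\le j\le m$ and the other indices are fixed elements of $[n]$. A $d$-dimensional permutation of order $n$ is an $[n]^{d+1}$ array of zeros and ones in which every line contains exactly one entry equal to $1$. (Equivalently, it is an $[n]^d$ array with entries in $[n]$ in which every line contains each element of $[n]$ exactly once.) $S_{d,n}$ denotes the set of all $d$-dimensional permutations of order $n$. *)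

theory Defs
  imports Complex_Main "HOL-Library.FuncSet"
begin

text \<open>
  The index set \<open>[n]^m\<close>. Index vectors and arrays are extensional functions, so that equality
  of arrays as HOL functions is equality of arrays, and cardinalities count each array once.
\<close>

definition index_set :: "nat \<Rightarrow> nat \<Rightarrow> (nat \<Rightarrow> nat) set" where
  "index_set n m = {1..m} \<rightarrow>\<^sub>E {1..n}"

definition arrays :: "nat \<Rightarrow> nat \<Rightarrow> nat set \<Rightarrow> ((nat \<Rightarrow> nat) \<Rightarrow> nat) set" where
  "arrays n m V = index_set n m \<rightarrow>\<^sub>E V"

text \<open>The line through position \<open>i\<close> in direction \<open>j\<close>; it does not depend on \<open>i j\<close>.\<close>

definition line :: "nat \<Rightarrow> ((nat \<Rightarrow> nat) \<Rightarrow> nat) \<Rightarrow> (nat \<Rightarrow> nat) \<Rightarrow> nat \<Rightarrow> (nat \<Rightarrow> nat)" where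
  "line n P i j = (\<lambda>t\<in>{1..n}. P (i(j := t)))"

definition lines :: "nat \<Rightarrow> nat \<Rightarrow> ((nat \<Rightarrow> nat) \<Rightarrow> nat) \<Rightarrow> (nat \<Rightarrow> nat) set" where
  "lines n m P = {line n P i j | i j. i \<in> index_set n m \<and> j \<in> {1..m}}"

definition high_dim_perms :: "nat \<Rightarrow> nat \<Rightarrow> ((nat \<Rightarrow> nat) \<Rightarrow> nat) set" where
  "high_dim_perms d n =
     {P \<in> arrays n (d + 1) {0, 1}. \<forall>L \<in> lines n (d + 1) P. \<exists>!t. t \<in> {1..n} \<and> L t = 1}"

lemma finite_high_dim_perms: "finite (high_dim_perms d n)"
proof -
  have "finite (arrays n (d + 1) {0, 1})"
    unfolding arrays_def index_set_def by (intro finite_PiE) auto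
  then show ?thesis
    unfolding high_dim_perms_def by simp
qed

end

theory Submission
  imports Defs
begin

text \<open>
  Let \<open>n = 2k\<close> and split each coordinate \<open>x \<in> [n]\<close> into a block \<open>(x - 1) div 2 \<in> \<int>/k\<close> and a
  parity. The positions whose blocks sum to \<open>0\<close> in \<open>\<int>/k\<close> form \<open>k ^ d\<close> subcubes of side \<open>2\<close>, and
  every line meets exactly one of them. Each subcube may be filled, independently of the others,
  with either of the two arrays supported on positions of a given total parity, which gives
  \<open>2 ^ (k ^ d)\<close> permutations.
\<close>

definition block :: "nat \<Rightarrow> nat" where
  "block x = (x - 1) div 2"

definition block_vectors :: "nat \<Rightarrow> nat \<Rightarrow> (nat \<Rightarrow> nat) set" where
  "block_vectors d k = {1..d} \<rightarrow>\<^sub>E {..<k}"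

text \<open>
  A subcube is named by its first \<open>d\<close> blocks, which determine the last one; \<open>S\<close> selects the
  subcubes filled on even positions.
\<close>

definition parity_perm :: "nat \<Rightarrow> nat \<Rightarrow> (nat \<Rightarrow> nat) set \<Rightarrow> (nat \<Rightarrow> nat) \<Rightarrow> nat" where
  "parity_perm d k S = (\<lambda>x\<in>index_set (2 * k) (d + 1).
     of_bool (k dvd (\<Sum>l\<in>{1..d + 1}. block (x l)) \<and>
       (even (\<Sum>l\<in>{1..d + 1}. x l) \<longleftrightarrow> (\<lambda>l\<in>{1..d}. block (x l)) \<in> S)))"

lemma ex_less_dvd_add:
  fixes k s :: nat
  assumes "k > 0"
  shows "\<exists>a<k. k dvd s + a"
proof (intro exI conjI)
  \<comment> \<open>The outer \<open>mod\<close> matters when \<open>k\<close> divides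
    \<open>s\<close>: there \<open>k - s mod k\<close> is \<open>k\<close> itself, and the witness
    must be 0.\<close>
  show "(k - s mod k) mod k < k"
    using assms by simp
  have "(s + (k - s mod k) mod k) mod k = (s mod k + (k - s mod k)) mod k"
    by (simp add: mod_simps)
  also have "\<dots> = 0"
    using assms by (simp add: less_imp_le)
  finally show "k dvd s + (k - s mod k) mod k"
    by (simp add: dvd_eq_mod_eq_0)
qed

lemma less_dvd_add_unique:
  fixes k s a b :: nat
  assumes "a < k" "b < k" "k dvd s + a" "k dvd s + b"
  shows "a = b"
proof -
  \<comment> \<open>Subtraction truncates, so both orders are taken: whichever of \<open>a\<close>,
    \<open>b\<close> is larger, a nonzero difference would be a multiple of \<open>k\<close> below
    \<open>k\<close>.\<close>
  have "k dvd a - b" "k dvd b - a"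
    using dvd_diff_nat[of k "s + a" "s + b"] dvd_diff_nat[of k "s + b" "s + a"] assms by auto
  then show ?thesis
    using dvd_imp_le[of k "a - b"] dvd_imp_le[of k "b - a"] assms by linarith
qed

text \<open>Divisibility by \<open>k\<close> forces the block of \<open>t\<close>; a block has two
  members of opposite parity, and the last condition picks one. \<open>Q\<close> may depend on the
  block because moving along a line can change the subcube's name.\<close>

lemma ex1_block_parity:
  fixes k s r :: nat
  assumes "k > 0"
  shows "\<exists>!t. t \<in> {1..2 * k} \<and> k dvd s + block t \<and> (even (r + t) \<longleftrightarrow> Q (block t))"
proof -
  obtain a where a: "a < k" "k dvd s + a"
    using ex_less_dvd_add assms by blast
  \<comment> \<open>Block \<open>a\<close> is \<open>{2 * a + 1, 2 * a + 2}\<close>, and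
    \<open>t\<close> has to be even exactly when \<open>even r = Q a\<close>.\<close>
  define t where "t = (if even r = Q a then 2 * a + 2 else 2 * a + 1)"
  show ?thesis
  proof (rule ex1I[of _ t])
    show "t \<in> {1..2 * k} \<and> k dvd s + block t \<and> (even (r + t) \<longleftrightarrow> Q (block t))"
      using a by (auto simp: t_def block_def)
  next
    fix u assume u: "u \<in> {1..2 * k} \<and> k dvd s + block u \<and> (even (r + u) \<longleftrightarrow> Q (block u))"
    then have "block u < k"
      by (auto simp: block_def)
    then have "block u = a"
      using u a less_dvd_add_unique by blast
    moreover from this have "u = 2 * a + 1 \<and> odd u \<or> u = 2 * a + 2 \<and> even u"
      using u unfolding block_def by (cases "even u") (auto elim!: evenE oddE)
    ultimately show "u = t"
      using u by (auto simp: t_def)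
  qed
qed

text \<open>Along a line only coordinate \<open>j\<close> varies, so both sums are a constant plus
  the contribution of \<open>t\<close>, which is the situation of
  \<open>ex1_block_parity\<close>.\<close>

lemma parity_perm_in_high_dim_perms:
  assumes "k > 0"
  shows "parity_perm d k S \<in> high_dim_perms d (2 * k)"
proof -
  have "\<exists>!t. t \<in> {1..2 * k} \<and> line (2 * k) (parity_perm d k S) i j t = 1"
    if i: "i \<in> index_set (2 * k) (d + 1)" and j: "j \<in> {1..d + 1}" for i j
  proof -
    define s where "s = (\<Sum>l\<in>{1..d + 1} - {j}. block (i l))"
    define r where "r = (\<Sum>l\<in>{1..d + 1} - {j}. i l)"
    \<comment> \<open>For \<open>j = d + 1\<close> the test \<open>l = j\<close> never succeeds and
      \<open>Q\<close> is constant: the last block is not part of the name.\<close>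
    define Q where "Q a \<longleftrightarrow> (\<lambda>l\<in>{1..d}. if l = j then a else block (i l)) \<in> S" for a
    have "line (2 * k) (parity_perm d k S) i j t = 1 \<longleftrightarrow>
        k dvd s + block t \<and> (even (r + t) \<longleftrightarrow> Q (block t))" if t: "t \<in> {1..2 * k}" for t
    proof -
      have "i(j := t) \<in> index_set (2 * k) (d + 1)"
        using i j t by (auto simp: index_set_def PiE_iff extensional_def)
      moreover have "(\<Sum>l\<in>{1..d + 1}. block ((i(j := t)) l)) = s + block t"
        using j by (subst sum.remove[of _ j]) (auto simp: s_def intro!: sum.cong)
      moreover have "(\<Sum>l\<in>{1..d + 1}. (i(j := t)) l) = r + t"
        using j by (subst sum.remove[of _ j]) (auto simp: r_def intro!: sum.cong)
      moreover have "(\<lambda>l\<in>{1..d}. block ((i(j := t)) l)) =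
          (\<lambda>l\<in>{1..d}. if l = j then block t else block (i l))"
        by auto
      ultimately have "parity_perm d k S (i(j := t)) =
          of_bool (k dvd s + block t \<and> (even (r + t) \<longleftrightarrow> Q (block t)))"
        by (simp only: parity_perm_def restrict_apply' Q_def)
      then show ?thesis
        using t by (simp add: line_def)
    qed
    then have "t \<in> {1..2 * k} \<and> line (2 * k) (parity_perm d k S) i j t = 1 \<longleftrightarrow>
        t \<in> {1..2 * k} \<and> k dvd s + block t \<and> (even (r + t) \<longleftrightarrow> Q (block t))" for t
      by blast
    then show ?thesis
      using ex1_block_parity[OF assms] by (simp only:)
  qed
  then have "\<forall>L \<in> lines (2 * k) (d + 1) (parity_perm d k S). \<exists>!t. t \<in> {1..2 * k} \<and> L t = 1"
    unfolding lines_def by blast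
  moreover have "parity_perm d k S \<in> arrays (2 * k) (d + 1) {0, 1}"
    unfolding arrays_def parity_perm_def by (intro restrict_PiE_iff[THEN iffD2] ballI) simp
  ultimately show ?thesis
    unfolding high_dim_perms_def by blast
qed

text \<open>One entry in the subcube named \<open>v\<close> already reveals whether \<open>v\<close>
  belongs to \<open>S\<close>.\<close>

lemma inj_on_parity_perm:
  assumes "k > 0"
  shows "inj_on (parity_perm d k) (Pow (block_vectors d k))"
proof (rule inj_onI)
  fix S T
  assume S: "S \<in> Pow (block_vectors d k)" and T: "T \<in> Pow (block_vectors d k)"
    and eq: "parity_perm d k S = parity_perm d k T"
  have "v \<in> S \<longleftrightarrow> v \<in> T" if v: "v \<in> block_vectors d k" for v
  proof -
    obtain a where a: "a < k" "k dvd (\<Sum>l\<in>{1..d}. v l) + a"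
      using ex_less_dvd_add assms by blast
    \<comment> \<open>The corner of the subcube named \<open>v\<close> with all coordinates odd;
      \<open>a\<close> is the last block that makes the block sum divisible by
      \<open>k\<close>.\<close>
    define x where "x = (\<lambda>l\<in>{1..d + 1}. 2 * (if l = d + 1 then a else v l) + 1)"
    have v_less: "v l < k" if "l \<in> {1..d}" for l
      using v that by (auto simp: block_vectors_def)
    have "x \<in> index_set (2 * k) (d + 1)"
      using a v_less by (fastforce simp: index_set_def x_def)
    moreover have "(\<Sum>l\<in>{1..d + 1}. block (x l)) = (\<Sum>l\<in>{1..d}. v l) + a"
      by (simp add: x_def block_def)
    moreover have "(\<lambda>l\<in>{1..d}. block (x l)) = v"
      using v by (auto simp: x_def block_def block_vectors_def PiE_iff extensional_def)
    ultimately have "parity_perm d k U x = of_bool (even (\<Sum>l\<in>{1..d + 1}. x l) \<longleftrightarrow> v \<in> U)" for U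
      using a by (simp add: parity_perm_def)
    from this[of S] this[of T]
    have "(even (\<Sum>l\<in>{1..d + 1}. x l) \<longleftrightarrow> v \<in> S) \<longleftrightarrow> (even (\<Sum>l\<in>{1..d + 1}. x l) \<longleftrightarrow> v \<in> T)"
      by (simp only: eq of_bool_eq_iff)
    then show ?thesis
      by blast
  qed
  then show "S = T"
    using S T by blast
qed

lemma card_high_dim_perms_ge:
  assumes "k > 0"
  shows "2 ^ (k ^ d) \<le> card (high_dim_perms d (2 * k))"
proof -
  have "card (Pow (block_vectors d k)) \<le> card (high_dim_perms d (2 * k))"
    using inj_on_parity_perm parity_perm_in_high_dim_perms assms
    by (intro card_inj_on_le[OF _ _ finite_high_dim_perms]) auto
  moreover have "finite (block_vectors d k)" "card (block_vectors d k) = k ^ d"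
    by (auto simp: block_vectors_def card_PiE finite_PiE)
  ultimately show ?thesis
    by (simp add: card_Pow)
qed

theorem mainTheorem3:
  fixes d :: nat
  assumes "d \<ge> 1"
  shows "\<exists>c::real. c > 0 \<and>
    (\<forall>n::nat. even n \<and> n \<ge> 2 \<longrightarrow> real (card (high_dim_perms d n)) \<ge> exp (c * real n ^ d))"
proof (intro exI[of _ "ln 2 / 2 ^ d"] conjI allI impI)
  show "ln 2 / 2 ^ d > (0::real)"
    by simp
next
  fix n :: nat assume n: "even n \<and> n \<ge> 2"
  then obtain k where k: "n = 2 * k"
    by (auto elim: evenE)
  \<comment> \<open>The factor \<open>2 ^ d\<close> in the constant cancels against
    \<open>n ^ d = 2 ^ d * k ^ d\<close>.\<close>
  have "exp (ln 2 / 2 ^ d * real n ^ d) = exp (real (k ^ d) * ln 2)"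
    by (simp add: k power_mult_distrib)
  also have "\<dots> = real (2 ^ (k ^ d))"
    by (subst exp_of_nat_mult) simp
  also have "\<dots> \<le> real (card (high_dim_perms d n))"
    using card_high_dim_perms_ge[of k d] n k by (simp del: of_nat_power)
  finally show "exp (ln 2 / 2 ^ d * real n ^ d) \<le> real (card (high_dim_perms d n))" .
qed

end
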